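(* Let $0<q\le 1$, $0\le\theta\le1$, and let $k\ge1$ be an integer. For an integer $n\ge0$ and an integer $x$ write $f_q(x;n,k;\theta)=P_{q,\theta}(E_{n,k}=x)$. Then for all integers $n>k+1$ and all $x\in\{0,1,\dots,\lfloor\frac{n+1}{k+1}\rfloor\}$, $$\begin{aligned}f_q(x;n,k;\theta)=\ &\theta f_q(x;n-1,k;\theta)+(1-\theta)\Big[f_q(x;n-1,k;\theta q)\\&+\theta^{k}\big\{f_q(x-1;n-k-1,k;\theta q)-f_q(x;n-k-1,k;\theta q)\big\}\\&+\theta^{k+1}\big\{f_q(x;n-k-2,k;\theta q)-f_q(x-1;n-k-2,k;\theta q)\big\}\Big],\end{aligned}$$ with $f_q(x;n,k;\theta)=0$ if $x<0$ or $x>\lfloor\frac{n+1}{k+1}\rfloor$; $f_q(x;n,k;\theta)=\delta_{x,0}$ if $0\le n<k$; $f_q(0;k,k;\theta)=1-\theta^{k}$; $f_q(1;k,k;\theta)=\theta^{k}$; $f_q(0;k+1,k;\theta)=1-\theta^{k}(1-\theta)(1+q^{k})$; and $f_q(1;k+1,k;\theta)=\theta^{k}(1-\theta)(1+q^{k})$.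
   Context: A $q$-sequence of binary trials with parameters $(\theta,q)$ is a sequence of $\{0,1\}$-valued random variables $X_1,X_2,\dots$ ($1$ = success, $0$ = failure) such that, conditionally on $X_1,\dots,X_{j-1}$, the probability that $X_j=1$ is $\theta q^{z}$, where $z=\sum_{m=1}^{j-1}(1-X_m)$ is the number of failures among the first $j-1$ trials (so the probability that $X_j=0$ is $1-\theta q^{z}$). For $q=1$ these are i.i.d. Bernoulli trials with success probability $\theta$. $P_{q,\theta}$ denotes probability under this model. A success run of length exactly $k$ is a block of $k$ consecutive ones that is preceded by a zero or by the beginning of the sequence and followed by a zero or by the end of the sequence. $E_{n,k}$ counts the success runs of length exactly $k$ in $X_1,\dots,X_n$; $E_{0,k}=0$. $\delta_{a,b}$ is the Kronecker delta. *)

theory Defs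
  imports "HOL-Probability.Probability"
begin

(* The trials are X 1, X 2, ...; the value X 0 is never used. Conditioning on X 1, ..., X (j-1) means
   conditioning on every history h 1, ..., h (j-1) of positive probability (such a history is
   {0,1}-valued, so the subtraction 1 - h m on nat is not truncated). *)
definition q_sequence :: "'a measure \<Rightarrow> (nat \<Rightarrow> 'a \<Rightarrow> nat) \<Rightarrow> real \<Rightarrow> real \<Rightarrow> bool" where
  "q_sequence M X \<theta> q \<longleftrightarrow>
     prob_space M \<and>
     (\<forall>j\<ge>1. X j \<in> measurable M (count_space {0, 1})) \<and>
     (\<forall>j\<ge>1. \<forall>h :: nat \<Rightarrow> nat.
        \<P>(\<omega> in M. \<forall>m\<in>{1..<j}. X m \<omega> = h m) > 0 \<longrightarrow>
        \<P>(\<omega> in M. X j \<omega> = 1 \<bar> \<forall>m\<in>{1..<j}. X m \<omega> = h m) = \<theta> * q ^ (\<Sum>m\<in>{1..<j}. 1 - h m))"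

(* Success runs of length exactly k among x 1, ..., x n; the run occupying the positions
   i, ..., i + k - 1 is identified with its starting position i. Intended for k >= 1. *)
definition exact_runs :: "nat \<Rightarrow> nat \<Rightarrow> (nat \<Rightarrow> nat) \<Rightarrow> nat" where
  "exact_runs n k x =
     card {i. 1 \<le> i \<and> i + k \<le> n + 1 \<and> (\<forall>m\<in>{i..<i + k}. x m = 1) \<and>
              (i = 1 \<or> x (i - 1) = 0) \<and> (i + k = n + 1 \<or> x (i + k) = 0)}"

(* The argument v is an integer so that the value x - 1 = -1 makes sense. *)
definition exact_runs_prob :: "'a measure \<Rightarrow> (nat \<Rightarrow> 'a \<Rightarrow> nat) \<Rightarrow> int \<Rightarrow> nat \<Rightarrow> nat \<Rightarrow> real" where
  "exact_runs_prob M X v n k = \<P>(\<omega> in M. int (exact_runs n k (\<lambda>j. X j \<omega>)) = v)"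

(* q-sequences exist for all parameters: toss independent coins indexed by (j, z) with success
   probability \<theta> * q ^ z, and let trial j use coin (j, z) if z failures have occurred before. *)
primrec fails :: "(nat \<times> nat \<Rightarrow> bool) \<Rightarrow> nat \<Rightarrow> nat" where
  "fails \<omega> 0 = 0"
| "fails \<omega> (Suc m) = fails \<omega> m + (if \<omega> (Suc m, fails \<omega> m) then 0 else 1)"

definition trial :: "nat \<Rightarrow> (nat \<times> nat \<Rightarrow> bool) \<Rightarrow> nat" where
  "trial j \<omega> = of_bool (\<omega> (j, fails \<omega> (j - 1)))"

lemma fails_eq_sum: "fails \<omega> m = (\<Sum>i\<in>{1..<Suc m}. 1 - trial i \<omega>)"
  by (induction m) (auto simp: trial_def)

lemma fails_cong:
  assumes "\<forall>i\<in>{1..<Suc m}. trial i \<omega> = h i"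
  shows "fails \<omega> m = (\<Sum>i\<in>{1..<Suc m}. 1 - h i)"
  unfolding fails_eq_sum using assms by (intro sum.cong) auto

lemma history_iff:
  assumes "\<forall>m\<in>{1..<Suc n}. h m \<in> {0, 1}"
  shows "(\<forall>m\<in>{1..<Suc n}. trial m \<omega> = h m) \<longleftrightarrow>
         (\<forall>m\<in>{1..<Suc n}. \<omega> (m, \<Sum>i\<in>{1..<m}. 1 - h i) = (h m = 1))"
  using assms
proof (induction n)
  case (Suc n)
  have split: "(\<forall>m\<in>{1..<Suc (Suc n)}. P m) \<longleftrightarrow> (\<forall>m\<in>{1..<Suc n}. P m) \<and> P (Suc n)" for P
    by (auto simp: less_Suc_eq)
  have "trial (Suc n) \<omega> = h (Suc n) \<longleftrightarrow> \<omega> (Suc n, \<Sum>i\<in>{1..<Suc n}. 1 - h i) = (h (Suc n) = 1)"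
    if "\<forall>m\<in>{1..<Suc n}. trial m \<omega> = h m"
  proof -
    have "h (Suc n) \<in> {0, 1}" using Suc.prems by auto
    then show ?thesis using fails_cong[OF that] by (auto simp: trial_def)
  qed
  moreover have "(\<forall>m\<in>{1..<Suc n}. trial m \<omega> = h m) \<longleftrightarrow>
         (\<forall>m\<in>{1..<Suc n}. \<omega> (m, \<Sum>i\<in>{1..<m}. 1 - h i) = (h m = 1))"
    using Suc by auto
  ultimately show ?case unfolding split by blast
qed simp

lemma q_sequence_exists:
  fixes \<theta> q :: real
  assumes "0 < q" "q \<le> 1" "0 \<le> \<theta>" "\<theta> \<le> 1"
  shows "\<exists>(M :: (nat \<times> nat \<Rightarrow> bool) measure) X. q_sequence M X \<theta> q"
proof -
  define B where "B = (\<lambda>p :: nat \<times> nat. measure_pmf (bernoulli_pmf (\<theta> * q ^ snd p)))"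
  define M where "M = PiM UNIV B"
  interpret P: product_prob_space B UNIV
    by unfold_locales (auto simp: B_def intro: measure_pmf.emeasure_space_1)
  have par: "0 \<le> \<theta> * q ^ z" "\<theta> * q ^ z \<le> 1" for z
    using assms mult_le_one[of \<theta> "q ^ z"] power_le_one[of q z] by auto
  have coin: "(\<lambda>\<omega>. \<omega> p) \<in> measurable M (count_space UNIV)" for p
    using measurable_component_singleton[of p UNIV B] by (simp add: M_def B_def)
  have F: "(\<lambda>\<omega>. fails \<omega> m) \<in> measurable M (count_space UNIV)" for m
  proof (induction m)
    case (Suc m)
    have "(\<lambda>\<omega>. z + (if \<omega> (Suc m, z) then 0 else 1)) \<in> measurable M (count_space UNIV)" for z :: nat
      using measurable_compose[OF coin, of "\<lambda>b. z + (if b then 0 else 1)" "count_space UNIV" "(Suc m, z)"] by simp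
    from measurable_compose_countable[OF this Suc] show ?case by simp
  qed simp
  have trial': "trial j \<in> measurable M (count_space UNIV)" for j
  proof -
    have "(\<lambda>\<omega>. of_bool (\<omega> (j, z)) :: nat) \<in> measurable M (count_space UNIV)" for z
      using measurable_compose[OF coin, of "of_bool" "count_space UNIV" "(j, z)"] by simp
    from measurable_compose_countable[OF this F[of "j - 1"]] show ?thesis
      by (simp add: trial_def[abs_def])
  qed
  have T: "trial j \<in> measurable M (count_space {0, 1})" for j
    using trial'[of j] by (auto simp: measurable_count_space_eq2 measurable_def trial_def)
  have hist: "\<P>(\<omega> in M. \<forall>m\<in>{1..<j}. trial m \<omega> = h m) =
      (\<Prod>m\<in>{1..<j}. pmf (bernoulli_pmf (\<theta> * q ^ (\<Sum>i\<in>{1..<m}. 1 - h i))) (h m = 1))"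
    if "j \<ge> 1" and h: "\<forall>m\<in>{1..<j}. h m \<in> {0, 1}" for j h
  proof -
    obtain n where j: "j = Suc n" using \<open>j \<ge> 1\<close> by (cases j) auto
    define c where "c m = (m, \<Sum>i\<in>{1..<m}. 1 - h i)" for m
    have c: "inj_on c {1..<j}" by (auto simp: inj_on_def c_def)
    have "{\<omega>\<in>space M. \<forall>m\<in>{1..<j}. trial m \<omega> = h m} =
        prod_emb UNIV B (c ` {1..<j}) (\<Pi>\<^sub>E p\<in>c ` {1..<j}. {h (fst p) = 1})"
      using history_iff[of n h] h unfolding j
      by (auto simp: c_def M_def B_def prod_emb_def space_PiM PiE_iff)
    also have "measure M \<dots> = (\<Prod>p\<in>c ` {1..<j}. measure (B p) {h (fst p) = 1})"
      unfolding M_def by (subst P.measure_PiM_emb) (auto simp: B_def)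
    also have "\<dots> = (\<Prod>m\<in>{1..<j}. pmf (bernoulli_pmf (\<theta> * q ^ (\<Sum>i\<in>{1..<m}. 1 - h i))) (h m = 1))"
      by (subst prod.reindex[OF c]) (simp add: B_def c_def pmf.rep_eq)
    finally show ?thesis .
  qed
  have "q_sequence M trial \<theta> q"
    unfolding q_sequence_def
  proof (intro conjI allI impI)
    show "prob_space M" unfolding M_def by (rule P.prob_space_axioms)
    fix j :: nat assume j: "1 \<le> j"
    show "trial j \<in> measurable M (count_space {0, 1})" by (rule T)
    fix h :: "nat \<Rightarrow> nat"
    assume pos: "\<P>(\<omega> in M. \<forall>m\<in>{1..<j}. trial m \<omega> = h m) > 0"
    then have "{\<omega>\<in>space M. \<forall>m\<in>{1..<j}. trial m \<omega> = h m} \<noteq> {}"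
      by (metis less_irrefl measure_empty)
    then obtain \<omega> where "\<forall>m\<in>{1..<j}. trial m \<omega> = h m" by auto
    then have h: "\<forall>m\<in>{1..<j}. h m \<in> {0, 1}"
      by (metis trial_def insertCI of_bool_eq_0_iff of_bool_eq_1_iff)
    let ?h = "h(j := 1)"
    have "{\<omega>\<in>space M. trial j \<omega> = 1 \<and> (\<forall>m\<in>{1..<j}. trial m \<omega> = h m)} =
        {\<omega>\<in>space M. \<forall>m\<in>{1..<Suc j}. trial m \<omega> = ?h m}"
      using j by (auto simp: less_Suc_eq)
    then have "\<P>(\<omega> in M. trial j \<omega> = 1 \<and> (\<forall>m\<in>{1..<j}. trial m \<omega> = h m)) =
        (\<Prod>m\<in>{1..<Suc j}. pmf (bernoulli_pmf (\<theta> * q ^ (\<Sum>i\<in>{1..<m}. 1 - ?h i))) (?h m = 1))"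
      using hist[of "Suc j" ?h] h by auto
    also have "\<dots> = (\<Prod>m\<in>{1..<j}. pmf (bernoulli_pmf (\<theta> * q ^ (\<Sum>i\<in>{1..<m}. 1 - ?h i))) (?h m = 1)) *
        pmf (bernoulli_pmf (\<theta> * q ^ (\<Sum>i\<in>{1..<j}. 1 - ?h i))) True"
      using j by simp
    also have "(\<Sum>i\<in>{1..<j}. 1 - ?h i) = (\<Sum>i\<in>{1..<j}. 1 - h i)"
      by (intro sum.cong) auto
    also have "(\<Prod>m\<in>{1..<j}. pmf (bernoulli_pmf (\<theta> * q ^ (\<Sum>i\<in>{1..<m}. 1 - ?h i))) (?h m = 1)) =
        (\<Prod>m\<in>{1..<j}. pmf (bernoulli_pmf (\<theta> * q ^ (\<Sum>i\<in>{1..<m}. 1 - h i))) (h m = 1))"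
      by (intro prod.cong arg_cong2[where f = pmf] arg_cong[where f = bernoulli_pmf]
          arg_cong2[where f = "(*)"] arg_cong2[where f = power] sum.cong) auto
    also have "\<dots> = \<P>(\<omega> in M. \<forall>m\<in>{1..<j}. trial m \<omega> = h m)"
      using hist[OF j h] by simp
    finally show "\<P>(\<omega> in M. trial j \<omega> = 1 \<bar> \<forall>m\<in>{1..<j}. trial m \<omega> = h m) =
        \<theta> * q ^ (\<Sum>m\<in>{1..<j}. 1 - h m)"
      using pos par by (simp add: cond_prob_def)
  qed
  then show ?thesis by blast
qed

end

theory Submission
  imports Defs
begin

text \<open>Condition on the number \<open>j\<close> of ones before the first zero. The trials after that zero
  form a \<open>q\<close>-sequence with parameter \<open>\<theta> * q\<close>, and the initial block contributes a run of length
  \<open>k\<close> precisely when \<open>j = k\<close>. This expresses \<open>f(x; n; \<theta>)\<close> as a sum over \<open>j\<close> of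
  \<open>\<theta>^j (1 - \<theta>) f(x - [j = k]; n - 1 - j; \<theta> q)\<close>, and in \<open>f(x; n; \<theta>) - \<theta> f(x; n - 1; \<theta>)\<close> all terms
  cancel except those with \<open>j \<in> {0, k, k + 1}\<close>.\<close>

section \<open>The law of the trials as a recursion on 0/1 words\<close>

text \<open>First-step analysis of a \<open>q\<close>-sequence: a failure multiplies the success
  probability of every later trial by \<open>q\<close>, so the number of past failures is carried by
  the parameter alone. No measure space occurs, hence sequences living on different spaces can be
  compared.\<close>

primrec trials_prob :: "real \<Rightarrow> real \<Rightarrow> nat \<Rightarrow> (nat list \<Rightarrow> bool) \<Rightarrow> real" where
  "trials_prob q \<theta> 0 P = of_bool (P [])"
| "trials_prob q \<theta> (Suc n) P =
     \<theta> * trials_prob q \<theta> n (\<lambda>l. P (1 # l)) + (1 - \<theta>) * trials_prob q (\<theta> * q) n (\<lambda>l. P (0 # l))"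

lemma trials_prob_cong:
  assumes "\<And>l. length l = n \<Longrightarrow> P l = Q l"
  shows "trials_prob q \<theta> n P = trials_prob q \<theta> n Q"
  using assms
proof (induction n arbitrary: \<theta> P Q)
  case (Suc n)
  have "trials_prob q \<theta>' n (\<lambda>l. P (b # l)) = trials_prob q \<theta>' n (\<lambda>l. Q (b # l))" for \<theta>' b
    by (intro Suc.IH Suc.prems) simp
  then show ?case by simp
qed simp

lemma trials_prob_const: "trials_prob q \<theta> n (\<lambda>_. c) = of_bool c"
  by (induction n arbitrary: \<theta>) (auto simp: algebra_simps)

lemma trials_prob_not: "trials_prob q \<theta> n (\<lambda>l. \<not> P l) = 1 - trials_prob q \<theta> n P"
proof (induction n arbitrary: \<theta> P)
  case (Suc n)
  show ?case unfolding trials_prob.simps Suc.IH by (simp add: algebra_simps)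
qed simp

text \<open>Words are classified by the number \<open>j\<close> of ones before the first zero; the
  last summand is the word without a zero. In the induction a leading zero yields the term
  \<open>j = 0\<close>, and a leading one shifts the remaining terms by one. Ones leave the
  parameter unchanged, so only \<open>P\<close> has to vary.\<close>

lemma trials_prob_first_zero:
  "trials_prob q \<theta> n P =
     (\<Sum>j<n. \<theta> ^ j * (1 - \<theta>) * trials_prob q (\<theta> * q) (n - 1 - j) (\<lambda>l. P (replicate j 1 @ 0 # l)))
     + \<theta> ^ n * of_bool (P (replicate n 1))"
proof (induction n arbitrary: P)
  case (Suc n)
  show ?case
    unfolding trials_prob.simps sum.lessThan_Suc_shift Suc.IH[of "\<lambda>l. P (1 # l)"]
    by (simp add: sum_distrib_left algebra_simps)
qed simp

section \<open>From a \<open>q\<close>-sequence on a probability space to the recursion\<close>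

lemma q_sequence_values:
  assumes "q_sequence M X \<theta> q" "1 \<le> j" "\<omega> \<in> space M"
  shows "X j \<omega> = 1 \<or> X j \<omega> = 0"
proof -
  have "X j \<in> measurable M (count_space {0, 1})"
    using assms(1,2) by (simp add: q_sequence_def)
  from measurable_space[OF this assms(3)] show ?thesis by auto
qed

lemma measurable_map_trials:
  assumes "q_sequence M X \<theta> q" "0 \<notin> set js"
  shows "(\<lambda>\<omega>. map (\<lambda>j. X j \<omega>) js) \<in> measurable M (count_space UNIV)"
  using assms(2)
proof (induction js)
  case (Cons j js)
  then have "X j \<in> measurable M (count_space {0, 1})"
    using assms(1) by (auto simp: q_sequence_def)
  then have X: "X j \<in> measurable M (count_space UNIV)"
    by (rule measurable_compose) simp
  have "(\<lambda>\<omega>. map (\<lambda>j. X j \<omega>) js) \<in> measurable M (count_space UNIV)"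
    using Cons by simp
  then have "(\<lambda>\<omega>. v # map (\<lambda>j. X j \<omega>) js) \<in> measurable M (count_space UNIV)" for v
    by (rule measurable_compose) simp
  from measurable_compose_countable[OF this X] show ?case by simp
qed simp

text \<open>Additivity of the measure below needs these events to be measurable. Writing the history
  as an equation between lists reduces this to random lists in a countable discrete space.\<close>

lemma history_event_sets:
  assumes "q_sequence M X \<theta> q"
  shows "{\<omega>\<in>space M. (\<forall>m\<in>{1..<Suc j}. X m \<omega> = h m) \<and> Q (map (\<lambda>i. X i \<omega>) [Suc j..<Suc j + n])} \<in> sets M"
proof -
  have "0 \<notin> set [1..<Suc j]" "0 \<notin> set [Suc j..<Suc j + n]" by auto
  note [measurable] = this[THEN measurable_map_trials[OF assms]]
  have "(\<forall>m\<in>{1..<Suc j}. X m \<omega> = h m) \<longleftrightarrow> map (\<lambda>i. X i \<omega>) [1..<Suc j] = map h [1..<Suc j]" for \<omega>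
    by (simp del: upt_Suc)
  then show ?thesis by (simp only:) measurable
qed

text \<open>Turns the conditional probabilities of the definition into a product rule that also
  covers histories of probability zero. The failure case follows from the success case by complement
  inside the history event.\<close>

lemma history_prob_snoc:
  assumes qs: "q_sequence M X \<theta> q"
  defines "H \<equiv> \<lambda>j h. \<P>(\<omega> in M. \<forall>m\<in>{1..<Suc j}. X m \<omega> = h m)"
    and "z \<equiv> \<lambda>j h. \<Sum>m\<in>{1..<Suc j}. (1::nat) - h m"
  shows "H (Suc j) (h(Suc j := 1)) = H j h * (\<theta> * q ^ z j h)"
    and "H (Suc j) (h(Suc j := 0)) = H j h * (1 - \<theta> * q ^ z j h)"
proof -
  interpret prob_space M using qs by (simp add: q_sequence_def)
  let ?A = "{\<omega>\<in>space M. \<forall>m\<in>{1..<Suc j}. X m \<omega> = h m}"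
  let ?B = "\<lambda>b. {\<omega>\<in>space M. \<forall>m\<in>{1..<Suc (Suc j)}. X m \<omega> = (h(Suc j := b)) m}"
  have sets: "{\<omega>\<in>space M. \<forall>m\<in>{1..<Suc j}. X m \<omega> = h m} \<in> sets M" for j h
    using history_event_sets[OF qs, of j h "\<lambda>_. True" 0] by simp
  have B: "?B b = {\<omega>\<in>space M. X (Suc j) \<omega> = b \<and> (\<forall>m\<in>{1..<Suc j}. X m \<omega> = h m)}" for b
    by (auto simp: less_Suc_eq)
  have 1: "prob (?B 1) = prob ?A * (\<theta> * q ^ z j h)"
  proof (cases "prob ?A > 0")
    case True
    then have "\<P>(\<omega> in M. X (Suc j) \<omega> = 1 \<bar> \<forall>m\<in>{1..<Suc j}. X m \<omega> = h m) = \<theta> * q ^ z j h"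
      using qs by (simp add: q_sequence_def z_def)
    with True show ?thesis unfolding B cond_prob_def by (simp add: field_simps)
  next
    \<comment> \<open>The definition is silent about null histories, but extending one gives a null
      event again, so both sides vanish.\<close>
    case False
    then have "prob ?A = 0" by (simp add: zero_less_measure_iff)
    moreover have "prob (?B 1) \<le> prob ?A" unfolding B by (intro finite_measure_mono sets) auto
    ultimately show ?thesis by (simp add: measure_le_0_iff)
  qed
  then show "H (Suc j) (h(Suc j := 1)) = H j h * (\<theta> * q ^ z j h)" by (simp only: H_def)
  have X01: "X (Suc j) \<omega> = 1 \<or> X (Suc j) \<omega> = 0" if "\<omega> \<in> space M" for \<omega>
    using q_sequence_values[OF qs _ that, of "Suc j"] by simp
  then have union: "?A = ?B 1 \<union> ?B 0"
    unfolding B Collect_disj_eq[symmetric] by (intro Collect_cong) metis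
  have "?B 1 \<inter> ?B 0 = {}" unfolding B by auto
  then have "prob ?A = prob (?B 1) + prob (?B 0)"
    by (subst union) (rule finite_measure_Union[OF sets sets])
  with 1 show "H (Suc j) (h(Suc j := 0)) = H j h * (1 - \<theta> * q ^ z j h)"
    by (simp only: H_def) (simp add: algebra_simps)
qed

text \<open>After a history with \<open>z\<close> failures the future behaves like a fresh sequence
  with parameter \<theta> * \<open>q ^ z\<close>. The induction on the length of the future moves
  its first trial into the history, which is why \<open>j\<close> and \<open>h\<close> are
  generalized.\<close>

lemma prob_history_and_future:
  assumes qs: "q_sequence M X \<theta> q"
  shows "\<P>(\<omega> in M. (\<forall>m\<in>{1..<Suc j}. X m \<omega> = h m) \<and> Q (map (\<lambda>i. X i \<omega>) [Suc j..<Suc j + n])) =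
     \<P>(\<omega> in M. \<forall>m\<in>{1..<Suc j}. X m \<omega> = h m) *
     trials_prob q (\<theta> * q ^ (\<Sum>m\<in>{1..<Suc j}. 1 - h m)) n Q"
proof (induction n arbitrary: j h Q)
  case 0
  then show ?case by (cases "Q []") simp_all
next
  case (Suc n)
  interpret prob_space M using qs by (simp add: q_sequence_def)
  let ?z = "\<lambda>j h. \<Sum>m\<in>{1..<Suc j}. (1::nat) - h m"
  let ?H = "\<lambda>j h. \<P>(\<omega> in M. \<forall>m\<in>{1..<Suc j}. X m \<omega> = h m)"
  let ?E = "\<lambda>b. {\<omega>\<in>space M. (\<forall>m\<in>{1..<Suc (Suc j)}. X m \<omega> = (h(Suc j := b)) m) \<and>
      Q (b # map (\<lambda>i. X i \<omega>) [Suc (Suc j)..<Suc (Suc j) + n])}"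
  let ?past = "\<lambda>\<omega>. \<forall>m\<in>{1..<Suc j}. X m \<omega> = h m"
  let ?future = "\<lambda>\<omega>. map (\<lambda>i. X i \<omega>) [Suc (Suc j)..<Suc (Suc j) + n]"
  have z: "?z (Suc j) (h(Suc j := b)) = ?z j h + (1 - b)" for b
  proof -
    have "(\<Sum>m\<in>{1..<Suc j}. 1 - (h(Suc j := b)) m) = ?z j h" by (intro sum.cong) auto
    then show ?thesis by simp
  qed
  have E: "prob (?E b) = ?H (Suc j) (h(Suc j := b)) * trials_prob q (\<theta> * q ^ (?z j h + (1 - b))) n (\<lambda>l. Q (b # l))" for b
    using Suc.IH[of "Suc j" "h(Suc j := b)" "\<lambda>l. Q (b # l)"] unfolding z .
  have upt: "[Suc j..<Suc j + Suc n] = Suc j # [Suc (Suc j)..<Suc (Suc j) + n]"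
    by (subst upt_conv_Cons) auto
  have X01: "X (Suc j) \<omega> = 1 \<or> X (Suc j) \<omega> = 0" if "\<omega> \<in> space M" for \<omega>
    using q_sequence_values[OF qs _ that, of "Suc j"] by simp
  have hist: "(\<forall>m\<in>{1..<Suc (Suc j)}. X m \<omega> = (h(Suc j := b)) m) \<longleftrightarrow>
      X (Suc j) \<omega> = b \<and> (\<forall>m\<in>{1..<Suc j}. X m \<omega> = h m)" for \<omega> b
    by (auto simp: less_Suc_eq)
  have union: "{\<omega>\<in>space M. (\<forall>m\<in>{1..<Suc j}. X m \<omega> = h m) \<and> Q (map (\<lambda>i. X i \<omega>) [Suc j..<Suc j + Suc n])}
      = ?E 1 \<union> ?E 0"
    unfolding upt list.map hist
  proof (intro set_eqI)
    fix \<omega>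
    show "\<omega> \<in> {\<omega>\<in>space M. ?past \<omega> \<and> Q (X (Suc j) \<omega> # ?future \<omega>)} \<longleftrightarrow>
        \<omega> \<in> {\<omega>\<in>space M. (X (Suc j) \<omega> = 1 \<and> ?past \<omega>) \<and> Q (1 # ?future \<omega>)} \<union>
          {\<omega>\<in>space M. (X (Suc j) \<omega> = 0 \<and> ?past \<omega>) \<and> Q (0 # ?future \<omega>)}"
    proof (cases "\<omega> \<in> space M")
      case True
      from X01[OF this] show ?thesis by (elim disjE) (simp_all del: upt_Suc)
    qed simp
  qed
  have val: "X (Suc j) \<omega> = b" if "\<omega> \<in> ?E b" for \<omega> b
  proof -
    have "Suc j \<in> {1..<Suc (Suc j)}" by simp
    with that have "X (Suc j) \<omega> = (h(Suc j := b)) (Suc j)" by blast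
    then show ?thesis by simp
  qed
  have disj: "?E 1 \<inter> ?E 0 = {}"
  proof (intro equals0I)
    fix \<omega> assume "\<omega> \<in> ?E 1 \<inter> ?E 0"
    then have "X (Suc j) \<omega> = 1" "X (Suc j) \<omega> = 0"
      using val[of \<omega> 1] val[of \<omega> 0] by blast+
    then show False by simp
  qed
  have sets: "?E b \<in> sets M" for b
    by (rule history_event_sets[OF qs])
  have "\<P>(\<omega> in M. (\<forall>m\<in>{1..<Suc j}. X m \<omega> = h m) \<and> Q (map (\<lambda>i. X i \<omega>) [Suc j..<Suc j + Suc n]))
      = prob (?E 1) + prob (?E 0)"
    unfolding union by (rule finite_measure_Union[OF sets sets disj])
  also have "\<dots> = ?H j h * trials_prob q (\<theta> * q ^ ?z j h) (Suc n) Q"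
    unfolding E history_prob_snoc[OF qs] by (simp add: algebra_simps)
  finally show ?case .
qed

section \<open>Counting runs of exact length in words\<close>

text \<open>Trials are numbered from 1 and list entries from 0, hence the shift. The truncation
  \<open>0 - 1 = 0\<close> does no harm: a run starting at 1 satisfies its left boundary condition
  without looking at position 0.\<close>

definition list_runs :: "nat \<Rightarrow> nat list \<Rightarrow> nat" where
  "list_runs k l = exact_runs (length l) k (\<lambda>j. l ! (j - 1))"

definition runs_prob :: "real \<Rightarrow> real \<Rightarrow> nat \<Rightarrow> int \<Rightarrow> nat \<Rightarrow> real" where
  "runs_prob q \<theta> k v n = trials_prob q \<theta> n (\<lambda>l. int (list_runs k l) = v)"

lemma exact_runs_cong:
  assumes "\<And>i. 1 \<le> i \<Longrightarrow> i \<le> n \<Longrightarrow> x i = y i"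
  shows "exact_runs n k x = exact_runs n k y"
proof -
  have "(1 \<le> i \<and> i + k \<le> n + 1 \<and> (\<forall>m\<in>{i..<i + k}. x m = 1) \<and>
          (i = 1 \<or> x (i - 1) = 0) \<and> (i + k = n + 1 \<or> x (i + k) = 0)) \<longleftrightarrow>
        (1 \<le> i \<and> i + k \<le> n + 1 \<and> (\<forall>m\<in>{i..<i + k}. y m = 1) \<and>
          (i = 1 \<or> y (i - 1) = 0) \<and> (i + k = n + 1 \<or> y (i + k) = 0))" for i
  proof (cases "1 \<le> i \<and> i + k \<le> n + 1")
    case True
    then have "x m = y m" if "m \<in> {i..<i + k}" for m using that by (intro assms) auto
    moreover have "i = 1 \<or> x (i - 1) = y (i - 1)" using True assms[of "i - 1"] by linarith
    moreover have "i + k = n + 1 \<or> x (i + k) = y (i + k)" using True assms[of "i + k"] by linarith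
    ultimately show ?thesis using True by auto
  qed auto
  then show ?thesis unfolding exact_runs_def by presburger
qed

text \<open>The law of the run count depends only on the parameters, not on the space that carries
  the sequence.\<close>

lemma exact_runs_prob_eq_runs_prob:
  assumes "q_sequence M X \<theta> q"
  shows "exact_runs_prob M X v n k = runs_prob q \<theta> k v n"
proof -
  have nth: "[1..<Suc n] ! (i - 1) = i" if "1 \<le> i" "i \<le> n" for i
    using that nth_upt[of 1 "i - 1" "Suc n"] by (simp del: upt_Suc)
  have "exact_runs n k (\<lambda>j. X j \<omega>) = list_runs k (map (\<lambda>i. X i \<omega>) [1..<Suc n])" for \<omega>
    unfolding list_runs_def length_map length_upt diff_Suc_1
  proof (rule exact_runs_cong)
    fix i assume i: "1 \<le> i" "i \<le> n"
    then have "i - 1 < length [1..<Suc n]" by (simp del: upt_Suc)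
    then show "X i \<omega> = map (\<lambda>i. X i \<omega>) [1..<Suc n] ! (i - 1)" by (simp only: nth_map nth[OF i])
  qed
  moreover have "prob_space M" using assms by (simp add: q_sequence_def)
  ultimately show ?thesis
    \<comment> \<open>With \<open>j = 0\<close> the history is empty: its probability is 1, it
      contains no failures, and the values of \<open>h\<close> are never read.\<close>
    using prob_history_and_future[OF assms, of 0 undefined "\<lambda>l. int (list_runs k l) = v" n]
    by (simp add: exact_runs_prob_def runs_prob_def prob_space.prob_space del: upt_Suc)
qed

text \<open>Each run together with the position after it fills \<open>k + 1\<close> positions. These
  blocks are pairwise disjoint and lie in \<open>{1..n + 1}\<close>, where \<open>n + 1\<close>
  serves a run that ends the sequence.\<close>

lemma exact_runs_bound: "exact_runs n k x \<le> (n + 1) div (k + 1)"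
proof -
  define S where "S = {i. 1 \<le> i \<and> i + k \<le> n + 1 \<and> (\<forall>m\<in>{i..<i + k}. x m = 1) \<and>
              (i = 1 \<or> x (i - 1) = 0) \<and> (i + k = n + 1 \<or> x (i + k) = 0)}"
  have S: "S \<subseteq> {1..n + 1}" unfolding S_def by auto
  then have fin: "finite S" by (rule finite_subset) simp
  \<comment> \<open>Otherwise position \<open>i' - 1\<close> would lie inside the run at
    \<open>i\<close> and carry a one, while a start \<open>i'\<close> other than 1 must be preceded
    by a zero.\<close>
  have less: "i + k < i'" if "i \<in> S" "i' \<in> S" "i < i'" for i i'
  proof (rule ccontr)
    assume "\<not> i + k < i'"
    with that have "i' - 1 \<in> {i..<i + k}" by auto
    with that show False by (auto simp: S_def)
  qed
  have disj: "{i..i + k} \<inter> {i'..i' + k} = {}" if "i \<in> S" "i' \<in> S" "i \<noteq> i'" for i i'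
    using less[of i i'] less[of i' i] that by (cases "i < i'") auto
  have "card S * (k + 1) = card (\<Union>i\<in>S. {i..i + k})"
    using fin disj by (subst card_UN_disjoint) auto
  also have "\<dots> \<le> card {1..n + 1}"
    by (intro card_mono) (auto simp: S_def)
  finally have "card S * (k + 1) \<le> n + 1" by simp
  then have "card S \<le> (n + 1) div (k + 1)" by (simp add: less_eq_div_iff_mult_less_eq)
  then show ?thesis by (simp add: exact_runs_def S_def)
qed

lemma list_runs_bound: "list_runs k l \<le> (length l + 1) div (k + 1)"
  unfolding list_runs_def by (rule exact_runs_bound)

lemma list_runs_replicate_one:
  assumes "1 \<le> k"
  shows "list_runs k (replicate n 1) = of_bool (n = k)"
proof -
  have "{i. 1 \<le> i \<and> i + k \<le> n + 1 \<and> (\<forall>m\<in>{i..<i + k}. replicate n 1 ! (m - 1) = (1::nat)) \<and>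
     (i = 1 \<or> replicate n 1 ! (i - 1 - 1) = (0::nat)) \<and>
     (i + k = n + 1 \<or> replicate n 1 ! (i + k - 1) = (0::nat))} = (if n = k then {1} else {})"
    using assms by (auto simp: nth_replicate)
  then show ?thesis by (simp add: list_runs_def exact_runs_def)
qed

text \<open>No run crosses the first zero, at position \<open>Suc j\<close>. Starts up to there
  concern only the initial block of ones; later starts are the starts in \<open>l\<close> shifted by
  \<open>Suc j\<close>.\<close>

lemma list_runs_first_zero:
  assumes "1 \<le> k"
  shows "list_runs k (replicate j 1 @ 0 # l) = of_bool (j = k) + list_runs k l"
proof -
  define x where "x i = (replicate j 1 @ 0 # l) ! (i - 1)" for i
  define y where "y i = l ! (i - 1)" for i
  define n where "n = length l"
  define R where "R n x i \<longleftrightarrow> 1 \<le> i \<and> i + k \<le> n + 1 \<and> (\<forall>m\<in>{i..<i + k}. x m = 1) \<and>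
     (i = 1 \<or> x (i - 1) = 0) \<and> (i + k = n + 1 \<or> x (i + k) = 0)" for n i and x :: "nat \<Rightarrow> nat"
  have one: "x i = 1" if "1 \<le> i" "i \<le> j" for i
    using that by (auto simp: x_def nth_append)
  have zero: "x (Suc j) = 0" by (simp add: x_def nth_append)
  have shift: "x (i + Suc j) = y i" if "1 \<le> i" for i
    using that by (cases i) (auto simp: x_def y_def nth_append)
  \<comment> \<open>A start after 1 would be preceded by a one. A run from 1 would cover the zero if
    \<open>j < k\<close>, and would be followed by a one if \<open>k < j\<close>.\<close>
  have low: "R (n + Suc j) x i \<longleftrightarrow> i = 1 \<and> j = k" if "i \<le> Suc j" for i
  proof
    assume R: "R (n + Suc j) x i"
    have "i = 1"
    proof (rule ccontr)
      assume "i \<noteq> 1"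
      with R that have "x (i - 1) = 1" by (intro one) (auto simp: R_def)
      with R \<open>i \<noteq> 1\<close> show False by (simp add: R_def)
    qed
    moreover have "k \<le> j"
    proof (rule ccontr)
      assume "\<not> k \<le> j"
      then have "Suc j \<in> {i..<i + k}" using \<open>i = 1\<close> by auto
      with R zero show False unfolding R_def by fastforce
    qed
    moreover have "\<not> k < j"
    proof
      assume "k < j"
      then have "x (i + k) = 1" "i + k \<noteq> n + Suc j + 1" using \<open>i = 1\<close> one[of "i + k"] by auto
      with R show False by (simp add: R_def)
    qed
    ultimately show "i = 1 \<and> j = k" by simp
  next
    assume "i = 1 \<and> j = k"
    then show "R (n + Suc j) x i" using one zero by (auto simp: R_def)
  qed
  have high: "R (n + Suc j) x (i + Suc j) \<longleftrightarrow> R n y i" if "1 \<le> i" for i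
  proof -
    have "{i + Suc j..<i + Suc j + k} = (\<lambda>m. m + Suc j) ` {i..<i + k}"
      by (simp only: image_add_atLeastLessThan') (simp add: ac_simps)
    then have "(\<forall>m\<in>{i + Suc j..<i + Suc j + k}. x m = 1) \<longleftrightarrow> (\<forall>m\<in>{i..<i + k}. x (m + Suc j) = 1)"
      by (simp only: Set.ball_simps)
    also have "\<dots> \<longleftrightarrow> (\<forall>m\<in>{i..<i + k}. y m = 1)"
      using that by (intro ball_cong) (auto simp: shift simp del: add_Suc_right)
    finally have 1: "(\<forall>m\<in>{i + Suc j..<i + Suc j + k}. x m = 1) \<longleftrightarrow> (\<forall>m\<in>{i..<i + k}. y m = 1)" .
    \<comment> \<open>The separating zero plays the part of the beginning of \<open>l\<close>: it
      provides the left boundary when \<open>i = 1\<close>.\<close>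
    have 2: "x (i + Suc j - 1) = (if i = 1 then 0 else y (i - 1))"
      using zero shift[of "i - 1"] that by (cases i) auto
    have 3: "x (i + Suc j + k) = y (i + k)"
      using shift[of "i + k"] that by (simp add: ac_simps)
    show ?thesis unfolding R_def 1 2 3 using that by auto
  qed
  have "{i. R (n + Suc j) x i} = {i. i = 1 \<and> j = k} \<union> (\<lambda>i. i + Suc j) ` {i. R n y i}" (is "_ = ?A \<union> ?B")
  proof (intro set_eqI)
    fix i
    show "i \<in> {i. R (n + Suc j) x i} \<longleftrightarrow> i \<in> ?A \<union> ?B"
    proof (cases "i \<le> Suc j")
      case True
      then have "i \<notin> ?B" by (auto simp: R_def)
      with low[OF True] show ?thesis by simp
    next
      case False
      then have "i = (i - Suc j) + Suc j" "1 \<le> i - Suc j" by auto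
      then obtain i' where "i = i' + Suc j" "1 \<le> i'" by blast
      with high[of i'] show ?thesis by auto
    qed
  qed
  moreover have "finite ?A" "finite ?B" "?A \<inter> ?B = {}"
    by (auto simp: R_def intro!: finite_imageI intro: finite_subset[of _ "{..n + 1}"])
  moreover have "card ?B = card {i. R n y i}" by (intro card_image) (simp add: inj_on_def)
  moreover have "card ?A = of_bool (j = k)" by simp
  ultimately have "card {i. R (n + Suc j) x i} = of_bool (j = k) + card {i. R n y i}"
    by (metis card_Un_disjoint)
  then show ?thesis
    by (simp add: list_runs_def exact_runs_def R_def n_def x_def y_def ac_simps)
qed

section \<open>The distribution of the run count: boundary values and recurrence\<close>

lemma runs_prob_first_zero:
  assumes "1 \<le> k"
  shows "runs_prob q \<theta> k v n =
     (\<Sum>j<n. \<theta> ^ j * (1 - \<theta>) * runs_prob q (\<theta> * q) k (v - of_bool (j = k)) (n - 1 - j))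
     + \<theta> ^ n * of_bool (v = of_bool (n = k))"
proof -
  have "int (of_bool b + r) = v \<longleftrightarrow> int r = v - of_bool b" "int (of_bool b) = v \<longleftrightarrow> v = of_bool b" for b r
    by auto
  then show ?thesis
    unfolding runs_prob_def trials_prob_first_zero[of q \<theta> n]
      list_runs_first_zero[OF assms] list_runs_replicate_one[OF assms]
    by (simp only:)
qed

lemma runs_prob_outside:
  assumes "v < 0 \<or> v > int ((n + 1) div (k + 1))"
  shows "runs_prob q \<theta> k v n = 0"
proof -
  have "runs_prob q \<theta> k v n = trials_prob q \<theta> n (\<lambda>_. False)"
    unfolding runs_prob_def
  proof (rule trials_prob_cong)
    fix l :: "nat list" assume "length l = n"
    then show "(int (list_runs k l) = v) = False" using list_runs_bound[of k l] assms by auto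
  qed
  then show ?thesis by (simp add: trials_prob_const)
qed

text \<open>There is room for at most one run, so the values 0 and 1 are complementary.\<close>

lemma runs_prob_zero:
  assumes "(n + 1) div (k + 1) \<le> 1"
  shows "runs_prob q \<theta> k 0 n = 1 - runs_prob q \<theta> k 1 n"
proof -
  have "runs_prob q \<theta> k 0 n = trials_prob q \<theta> n (\<lambda>l. \<not> int (list_runs k l) = 1)"
    unfolding runs_prob_def
  proof (rule trials_prob_cong)
    fix l :: "nat list" assume "length l = n"
    then show "(int (list_runs k l) = 0) = (\<not> int (list_runs k l) = 1)"
      using list_runs_bound[of k l] assms by auto
  qed
  then show ?thesis by (simp add: trials_prob_not runs_prob_def)
qed

lemma runs_prob_short:
  assumes "n < k"
  shows "runs_prob q \<theta> k v n = of_bool (v = 0)"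
proof -
  have [simp]: "Suc n div Suc k = 0" using assms by simp
  show ?thesis
    using runs_prob_outside[of v n k q \<theta>] runs_prob_zero[of n k q \<theta>] runs_prob_outside[of 1 n k q \<theta>]
    by (cases v "0 :: int" rule: linorder_cases) auto
qed

lemma runs_prob_one:
  assumes "1 \<le> k"
  shows "runs_prob q \<theta> k 1 k = \<theta> ^ k"
    and "runs_prob q \<theta> k 1 (k + 1) = \<theta> ^ k * (1 - \<theta>) * (1 + q ^ k)"
proof -
  \<comment> \<open>Every word with a zero leaves fewer than \<open>k\<close> trials after it, and
    its initial block is shorter than \<open>k\<close>; only the all-ones word contributes. The
    parameter is generalized for later use at \<theta> * \<open>q\<close>.\<close>
  show k: "runs_prob q \<theta> k 1 k = \<theta> ^ k" for \<theta>
    by (subst runs_prob_first_zero[OF assms]) (simp add: runs_prob_short)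
  have "runs_prob q \<theta> k 1 (k + 1) =
      (\<Sum>j<k+1. \<theta> ^ j * (1 - \<theta>) * runs_prob q (\<theta> * q) k (1 - of_bool (j = k)) (k - j))"
    by (subst runs_prob_first_zero[OF assms]) simp
  \<comment> \<open>For \<open>0 < j < k\<close> the initial block is no run of length
    \<open>k\<close> and the \<open>k - j\<close> remaining trials are too few for one. The term
    \<open>j = 0\<close> produces \<open>q ^ k\<close>, the term \<open>j = k\<close> produces
    1.\<close>
  also have "\<dots> = (\<Sum>j\<in>{0, k}. \<theta> ^ j * (1 - \<theta>) * runs_prob q (\<theta> * q) k (1 - of_bool (j = k)) (k - j))"
    using assms by (intro sum.mono_neutral_right) (auto simp: runs_prob_short)
  also have "\<dots> = \<theta> ^ k * (1 - \<theta>) * (1 + q ^ k)"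
    using assms by (simp add: k runs_prob_short power_mult_distrib algebra_simps)
  finally show "runs_prob q \<theta> k 1 (k + 1) = \<theta> ^ k * (1 - \<theta>) * (1 + q ^ k)" .
qed

lemma runs_prob_recurrence:
  assumes k: "1 \<le> k" and n: "n > k + 1"
  shows "runs_prob q \<theta> k v n = \<theta> * runs_prob q \<theta> k v (n - 1) + (1 - \<theta>) *
     (runs_prob q (\<theta> * q) k v (n - 1)
      + \<theta> ^ k * (runs_prob q (\<theta> * q) k (v - 1) (n - k - 1) - runs_prob q (\<theta> * q) k v (n - k - 1))
      + \<theta> ^ (k + 1) * (runs_prob q (\<theta> * q) k v (n - k - 2) - runs_prob q (\<theta> * q) k (v - 1) (n - k - 2)))"
proof -
  \<comment> \<open>Since \<open>k < m < n\<close>, the term \<open>j = k\<close> occurs in the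
    expansions for both lengths \<open>n\<close> and \<open>m\<close>, and neither all-ones word is
    a run of length \<open>k\<close>.\<close>
  obtain m where m: "n = Suc m" "k < m" using n by (cases n) auto
  define g where "g = runs_prob q (\<theta> * q) k"
  define T where "T j = \<theta> ^ j * (1 - \<theta>)" for j
  have "runs_prob q \<theta> k v n = (\<Sum>j<Suc m. T j * g (v - of_bool (j = k)) (m - j)) + \<theta> ^ n * of_bool (v = 0)"
    using m by (subst runs_prob_first_zero[OF k]) (simp add: g_def T_def)
  \<comment> \<open>The shift of \<open>v\<close> affects only \<open>j = k\<close>; it is split off
    as a correction so that the main sum has \<open>v\<close> throughout.\<close>
  also have "(\<Sum>j<Suc m. T j * g (v - of_bool (j = k)) (m - j)) =
      (\<Sum>j<Suc m. T j * g v (m - j)) + (\<Sum>j<Suc m. if j = k then T k * (g (v - 1) (m - k) - g v (m - k)) else 0)"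
    unfolding sum.distrib[symmetric] by (intro sum.cong) (auto simp: algebra_simps)
  also have "\<dots> = T 0 * g v m + (\<Sum>j<m. T (Suc j) * g v (m - 1 - j)) + T k * (g (v - 1) (m - k) - g v (m - k))"
    using m by (subst sum.lessThan_Suc_shift) (simp del: sum.lessThan_Suc)
  finally have 1: "runs_prob q \<theta> k v n = \<dots> + \<theta> ^ n * of_bool (v = 0)" .
  have "runs_prob q \<theta> k v m = (\<Sum>j<m. T j * g (v - of_bool (j = k)) (m - 1 - j)) + \<theta> ^ m * of_bool (v = 0)"
    using m by (subst runs_prob_first_zero[OF k]) (simp add: g_def T_def)
  also have "(\<Sum>j<m. T j * g (v - of_bool (j = k)) (m - 1 - j)) =
      (\<Sum>j<m. T j * g v (m - 1 - j)) + (\<Sum>j<m. if j = k then T k * (g (v - 1) (m - 1 - k) - g v (m - 1 - k)) else 0)"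
    unfolding sum.distrib[symmetric] by (intro sum.cong) (auto simp: algebra_simps)
  finally have 2: "runs_prob q \<theta> k v m = (\<Sum>j<m. T j * g v (m - 1 - j))
      + T k * (g (v - 1) (m - 1 - k) - g v (m - 1 - k)) + \<theta> ^ m * of_bool (v = 0)"
    using m by simp
  \<comment> \<open>This is the cancellation: after the term \<open>j = 0\<close> is removed, the
    main sum for \<open>n\<close> is \<theta> times the main sum for \<open>m\<close>, and the
    all-ones terms match in the same way. The correction for \<open>m\<close>, multiplied by
    \<theta>, leaves the terms with exponent \<open>k + 1\<close>.\<close>
  have 3: "(\<Sum>j<m. T (Suc j) * g v (m - 1 - j)) = \<theta> * (\<Sum>j<m. T j * g v (m - 1 - j))"
    by (simp add: T_def sum_distrib_left algebra_simps)
  have "n - 1 = m" "n - k - 1 = m - k" "n - k - 2 = m - 1 - k" using m by auto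
  then show ?thesis
    unfolding 1 3 using 2 m by (simp add: g_def[symmetric]) (simp add: T_def algebra_simps)
qed

theorem corollary3p1:
  fixes q \<theta> :: real and k :: nat
    and M :: "'a measure" and X :: "nat \<Rightarrow> 'a \<Rightarrow> nat"
    and N :: "'b measure" and Y :: "nat \<Rightarrow> 'b \<Rightarrow> nat"
  assumes "0 < q" and "q \<le> 1" and "0 \<le> \<theta>" and "\<theta> \<le> 1" and "1 \<le> k"
    and "q_sequence M X \<theta> q" and "q_sequence N Y (\<theta> * q) q"
  shows
    "(\<forall>n x. n > k + 1 \<longrightarrow> 0 \<le> x \<longrightarrow> x \<le> int ((n + 1) div (k + 1)) \<longrightarrow>
        exact_runs_prob M X x n k =
          \<theta> * exact_runs_prob M X x (n - 1) k
          + (1 - \<theta>) *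
            (exact_runs_prob N Y x (n - 1) k
             + \<theta> ^ k * (exact_runs_prob N Y (x - 1) (n - k - 1) k
                        - exact_runs_prob N Y x (n - k - 1) k)
             + \<theta> ^ (k + 1) * (exact_runs_prob N Y x (n - k - 2) k
                              - exact_runs_prob N Y (x - 1) (n - k - 2) k)))
     \<and> (\<forall>n x. x < 0 \<or> x > int ((n + 1) div (k + 1)) \<longrightarrow> exact_runs_prob M X x n k = 0)
     \<and> (\<forall>n x. n < k \<longrightarrow> exact_runs_prob M X x n k = (if x = 0 then 1 else 0))
     \<and> exact_runs_prob M X 0 k k = 1 - \<theta> ^ k
     \<and> exact_runs_prob M X 1 k k = \<theta> ^ k
     \<and> exact_runs_prob M X 0 (k + 1) k = 1 - \<theta> ^ k * (1 - \<theta>) * (1 + q ^ k)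
     \<and> exact_runs_prob M X 1 (k + 1) k = \<theta> ^ k * (1 - \<theta>) * (1 + q ^ k)"
  \<comment> \<open>The first fact gives \<open>(k + 2) div (k + 1) < 2\<close> for positive
    \<open>k\<close>, so \<open>runs_prob_zero\<close> applies at length
    \<open>k + 1\<close>.\<close>
  using div_less_iff_less_mult[of "k + 1" "k + 2" 2] runs_prob_recurrence[OF \<open>1 \<le> k\<close>] runs_prob_one[OF \<open>1 \<le> k\<close>]
    runs_prob_zero[of k k] runs_prob_zero[of "k + 1" k] \<open>1 \<le> k\<close>
  unfolding exact_runs_prob_eq_runs_prob[OF \<open>q_sequence M X \<theta> q\<close>]
    exact_runs_prob_eq_runs_prob[OF \<open>q_sequence N Y (\<theta> * q) q\<close>]
  by (intro conjI allI impI) (auto simp: runs_prob_outside runs_prob_short)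

end
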